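(* Let $(X,<)$ be a finite strict poset with a non-empty order relation (i.e. there exist $a,b\in X$ with $a<b$), and let $\varepsilon>0$. Then the ultrametric completion map $\mathfrak{U}_\varepsilon$, sending a partial dendrogram $\theta\in\mathcal{PD}(X,<)$ to the ultrametric $\mathfrak{U}_\varepsilon(\theta)$ on $X$, is injective.
   Context: $\mathbb{R}_+$ denotes the non-negative reals. An ultrametric on $X$ here is a map $d:X\times X\to\mathbb{R}_+$ with $d(x,x)=0$, $d(x,y)=d(y,x)$ and $d(x,z)\le\max\{d(x,y),d(y,z)\}$. Partitions are ordered by refinement; $S(X)$ is the singleton partition of $X$. Regular partitions: for an equivalence relation $\mathscr R$ on $X$ let $S$ be the transitive closure of the relation $S_0$ on $X/\mathscr{R}$ defined by $([a],[b])\in S_0\iff\exists x\in[a],y\in[b]:x<y$. The partition $X/\mathscr{R}$ of $(X,<)$ is regular if $S$ is a strict partial order (irreflexive and transitive) on $X/\mathscr R$. Partial dendrograms: $\mathcal{PD}(X,<)$ is the set of monotone maps $\theta$ from $(\mathbb{R}_+,\le)$ to the regular partitions of $(X,<)$ such that (D1) for every $t\in\mathbb{R}_+$ there is $\delta>0$ with $\theta(t)=\theta(t+\delta)$, and (D3) $\theta(0)=S(X)$. A partial dendrogram is eventually constant; $\theta(\infty)$ denotes its eventual value, and $\operatorname{diam}(\theta)=\min\{t\in\mathbb{R}_+\mid\theta(t)=\theta(\infty)\}$. Ultrametric completion: $$\mathfrak{U}_\varepsilon(\theta)(x,y)=\begin{cases}\min\{t\in\mathbb{R}_+\mid\exists B\in\theta(t):x,y\in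 B\}&\text{if } x,y\text{ lie in the same block of }\theta(\infty),\\ \operatorname{diam}(\theta)+\varepsilon&\text{otherwise.}\end{cases}$$ *)

theory Defs
  imports Complex_Main "HOL-Library.FuncSet" "HOL-Library.Disjoint_Sets"
begin

definition strict_poset :: "'a set \<Rightarrow> ('a \<times> 'a) set \<Rightarrow> bool" where
  "strict_poset X r \<longleftrightarrow> r \<subseteq> X \<times> X \<and> irrefl_on X r \<and> trans_on X r"

definition block_rel :: "('a \<times> 'a) set \<Rightarrow> 'a set set \<Rightarrow> ('a set \<times> 'a set) set" where
  "block_rel r P = {(A, B). A \<in> P \<and> B \<in> P \<and> (\<exists>x\<in>A. \<exists>y\<in>B. (x, y) \<in> r)}"

definition regular_partitions :: "'a set \<Rightarrow> ('a \<times> 'a) set \<Rightarrow> 'a set set set" where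
  "regular_partitions X r =
     {X // R | R. equiv X R \<and> strict_poset (X // R) ((block_rel r (X // R))\<^sup>+)}"

definition singleton_partition :: "'a set \<Rightarrow> 'a set set" where
  "singleton_partition X = (\<lambda>x. {x}) ` X"

text \<open>Functions with a restricted domain (the non-negative reals below, and \<open>X \<times> X\<close> further
  down) are extensional, so that equality as HOL functions is equality on that domain.
  In \<^const>\<open>refines\<close> the finer partition comes first.\<close>

definition partial_dendrograms ::
    "'a set \<Rightarrow> ('a \<times> 'a) set \<Rightarrow> (real \<Rightarrow> 'a set set) set" where
  "partial_dendrograms X r =
     {\<theta> \<in> {0..} \<rightarrow>\<^sub>E regular_partitions X r.
        monotone_on {0..} (\<le>) (refines X) \<theta> \<and>
        (\<forall>t\<ge>0. \<exists>\<delta>>0. \<theta> t = \<theta> (t + \<delta>)) \<and>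
        \<theta> 0 = singleton_partition X}"

definition ultrametrics :: "'a set \<Rightarrow> ('a \<times> 'a \<Rightarrow> real) set" where
  "ultrametrics X =
     {d \<in> X \<times> X \<rightarrow>\<^sub>E {0..}.
        (\<forall>x\<in>X. d (x, x) = 0) \<and>
        (\<forall>x\<in>X. \<forall>y\<in>X. d (x, y) = d (y, x)) \<and>
        (\<forall>x\<in>X. \<forall>y\<in>X. \<forall>z\<in>X. d (x, z) \<le> max (d (x, y)) (d (y, z)))}"

definition eventual_value :: "(real \<Rightarrow> 'b) \<Rightarrow> 'b" where
  "eventual_value \<theta> = (THE P. \<forall>\<^sub>F t in at_top. \<theta> t = P)"

text \<open>Minima of sets of reals are written with \<^const>\<open>Least\<close>, since \<^const>\<open>Min\<close> is
  only meaningful for finite sets.\<close>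

definition dendrogram_diam :: "(real \<Rightarrow> 'a set set) \<Rightarrow> real" where
  "dendrogram_diam \<theta> = (LEAST t. 0 \<le> t \<and> \<theta> t = eventual_value \<theta>)"

definition ultrametric_completion ::
    "'a set \<Rightarrow> real \<Rightarrow> (real \<Rightarrow> 'a set set) \<Rightarrow> ('a \<times> 'a \<Rightarrow> real)" where
  "ultrametric_completion X \<epsilon> \<theta> =
     (\<lambda>(x, y) \<in> X \<times> X.
        if \<exists>B\<in>eventual_value \<theta>. x \<in> B \<and> y \<in> B
        then (LEAST t. 0 \<le> t \<and> (\<exists>B\<in>\<theta> t. x \<in> B \<and> y \<in> B))
        else dendrogram_diam \<theta> + \<epsilon>)"

end

theory Submission
  imports Defs
begin

text \<open>Being in a common block is an up-closed, right-closed condition on the height, so the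
  heights at which a given pair is joined form either the empty set or a ray from its least
  element, and the completion assigns the value \<open>diam + \<epsilon>\<close> exactly to the pairs that are
  never joined.  Two order-related elements are never joined in a regular partition; hence the
  completion determines \<open>diam\<close>, and then the pairs joined at every height.\<close>

section \<open>Partitions encoded by their same-block relations\<close>

definition same_block :: "'a set set \<Rightarrow> 'a \<Rightarrow> 'a \<Rightarrow> bool" where
  "same_block P x y \<longleftrightarrow> (\<exists>B\<in>P. x \<in> B \<and> y \<in> B)"

lemma same_block_commute: "same_block P x y \<longleftrightarrow> same_block P y x"
  by (auto simp: same_block_def)

lemma same_block_refl: "partition_on X P \<Longrightarrow> x \<in> X \<Longrightarrow> same_block P x x"
  by (auto simp: same_block_def partition_on_def)

lemma same_block_carrier: "partition_on X P \<Longrightarrow> same_block P x y \<Longrightarrow> x \<in> X \<and> y \<in> X"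
  unfolding same_block_def partition_on_def by blast

lemma same_block_trans:
  assumes "partition_on X P" "same_block P x y" "same_block P y z"
  shows "same_block P x z"
proof -
  obtain A B where "A \<in> P" "x \<in> A" "y \<in> A" "B \<in> P" "y \<in> B" "z \<in> B"
    using assms(2,3) by (auto simp: same_block_def)
  moreover from this have "A = B"
    using partition_onD2[OF assms(1)] by (auto dest: disjointD)
  ultimately show ?thesis
    by (auto simp: same_block_def)
qed

lemma same_block_refines: "refines X P Q \<Longrightarrow> same_block P x y \<Longrightarrow> same_block Q x y"
  unfolding same_block_def refines_def by blast

lemma partition_on_eq_quotient_same_block:
  assumes "partition_on X P"
  shows "X // {(x, y). same_block P x y} = P"
  using partition_on_eq_quotient[OF assms] by (simp add: same_block_def)

text \<open>A partition is the quotient of \<open>X\<close> by its same-block relation, so equality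
  of partitions can be checked pair by pair.\<close>

lemma partition_on_eqI:
  assumes P: "partition_on X P" and Q: "partition_on X Q"
    and eq: "\<And>x y. x \<in> X \<Longrightarrow> y \<in> X \<Longrightarrow> same_block P x y \<longleftrightarrow> same_block Q x y"
  shows "P = Q"
proof -
  \<comment> \<open>Outside \<open>X\<close> both sides are false, so agreement on \<open>X\<close>
    is agreement everywhere.\<close>
  have "same_block P x y \<longleftrightarrow> same_block Q x y" for x y
    using eq[of x y] same_block_carrier[OF P] same_block_carrier[OF Q] by blast
  then have "X // {(x, y). same_block P x y} = X // {(x, y). same_block Q x y}"
    by simp
  then show ?thesis
    unfolding partition_on_eq_quotient_same_block[OF P] partition_on_eq_quotient_same_block[OF Q] .
qed

section \<open>Regular partitions and basic facts on partial dendrograms\<close>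

lemma regular_partitions_partition_on:
  "P \<in> regular_partitions X r \<Longrightarrow> partition_on X P"
  by (auto simp: regular_partitions_def intro: partition_on_quotient)

text \<open>A block containing both \<open>a\<close> and \<open>b\<close> would be a loop of
  \<open>block_rel\<close>, against irreflexivity of its transitive closure.\<close>

lemma regular_partitions_not_same_block:
  assumes "P \<in> regular_partitions X r" "(a, b) \<in> r"
  shows "\<not> same_block P a b"
proof
  assume "same_block P a b"
  then obtain B where B: "B \<in> P" "a \<in> B" "b \<in> B"
    by (auto simp: same_block_def)
  then have "(B, B) \<in> (block_rel r P)\<^sup>+"
    using assms(2) by (auto simp: block_rel_def)
  moreover have "irrefl_on P ((block_rel r P)\<^sup>+)"
    using assms(1) by (auto simp: regular_partitions_def strict_poset_def)
  ultimately show False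
    using B(1) by (auto simp: irrefl_on_def)
qed

lemma partial_dendrograms_regular:
  "\<theta> \<in> partial_dendrograms X r \<Longrightarrow> 0 \<le> t \<Longrightarrow> \<theta> t \<in> regular_partitions X r"
  by (auto simp: partial_dendrograms_def)

lemma partial_dendrograms_partition_on:
  "\<theta> \<in> partial_dendrograms X r \<Longrightarrow> 0 \<le> t \<Longrightarrow> partition_on X (\<theta> t)"
  by (blast intro: partial_dendrograms_regular regular_partitions_partition_on)

lemma partial_dendrograms_refines:
  "\<theta> \<in> partial_dendrograms X r \<Longrightarrow> 0 \<le> s \<Longrightarrow> s \<le> t \<Longrightarrow> refines X (\<theta> s) (\<theta> t)"
  by (auto simp: partial_dendrograms_def monotone_on_def)

lemma partial_dendrograms_same_block_mono:
  "\<theta> \<in> partial_dendrograms X r \<Longrightarrow> 0 \<le> s \<Longrightarrow> s \<le> t \<Longrightarrow> same_block (\<theta> s) x y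
    \<Longrightarrow> same_block (\<theta> t) x y"
  by (blast intro: same_block_refines partial_dendrograms_refines)

section \<open>Attained minima and eventual constancy\<close>

text \<open>Condition (D1) acts as right-continuity, so the infimum of the heights with an up-closed
  property is attained. The predicate \<open>Q\<close> is left abstract to serve both minima in the
  definitions: the diameter and the joining height of a pair.\<close>

lemma partial_dendrograms_Least:
  assumes \<theta>: "\<theta> \<in> partial_dendrograms X r"
    and up: "\<And>s t. 0 \<le> s \<Longrightarrow> s \<le> t \<Longrightarrow> Q (\<theta> s) \<Longrightarrow> Q (\<theta> t)"
    and ex: "0 \<le> s" "Q (\<theta> s)"
  defines "m \<equiv> LEAST t. 0 \<le> t \<and> Q (\<theta> t)"
  shows "0 \<le> m" and "\<And>t. 0 \<le> t \<Longrightarrow> Q (\<theta> t) \<longleftrightarrow> m \<le> t"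
proof -
  define A where "A = {t. 0 \<le> t \<and> Q (\<theta> t)}"
  have bdd: "bdd_below A" and ne: "A \<noteq> {}"
    using ex by (auto simp: A_def)
  have nonneg: "0 \<le> Inf A"
    by (rule cInf_greatest[OF ne]) (auto simp: A_def)
  obtain \<delta> where \<delta>: "\<delta> > 0" "\<theta> (Inf A) = \<theta> (Inf A + \<delta>)"
    using \<theta> nonneg by (force simp: partial_dendrograms_def)
  \<comment> \<open>Some height with the property lies below \<open>Inf A + \<delta>\<close>;
    up-closure carries it to \<open>Inf A + \<delta>\<close>, where \<open>\<theta>\<close> has the
    same value as at \<open>Inf A\<close>.\<close>
  obtain t where "t \<in> A" "t < Inf A + \<delta>"
    using cInf_lessD[OF ne, of "Inf A + \<delta>"] \<delta>(1) by auto
  then have "Q (\<theta> (Inf A))"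
    using up[of t "Inf A + \<delta>"] \<delta>(2) by (auto simp: A_def)
  moreover have "Inf A \<le> t" if "0 \<le> t" "Q (\<theta> t)" for t
    using that by (intro cInf_lower[OF _ bdd]) (auto simp: A_def)
  ultimately have m: "m = Inf A"
    unfolding m_def using nonneg by (intro Least_equality) auto
  show "0 \<le> m"
    using nonneg m by simp
  show "Q (\<theta> t) \<longleftrightarrow> m \<le> t" if "0 \<le> t" for t
    using that up[OF nonneg, of t] \<open>Q (\<theta> (Inf A))\<close> m
      \<open>\<And>t. 0 \<le> t \<Longrightarrow> Q (\<theta> t) \<Longrightarrow> Inf A \<le> t\<close> by blast
qed

text \<open>Only finitely many pairs can become joined; beyond one joining height for each of them
  nothing changes any more.\<close>

lemma partial_dendrograms_eventually_const:
  assumes "finite X" and \<theta>: "\<theta> \<in> partial_dendrograms X r"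
  obtains T where "0 \<le> T" "\<And>t. T \<le> t \<Longrightarrow> \<theta> t = \<theta> T"
proof -
  let ?S = "\<lambda>p t. 0 \<le> t \<and> same_block (\<theta> t) (fst p) (snd p)"
  \<comment> \<open>Any joining height will do. The default 0 for pairs that are never joined is
    harmless, since \<open>f p\<close> must be a joining height only if one exists.\<close>
  define f where "f p = (if \<exists>t. ?S p t then SOME t. ?S p t else 0)" for p
  have f: "?S p (f p)" if "?S p t" for p t
    using that someI_ex[of "?S p"] by (auto simp: f_def)
  \<comment> \<open>Inserting 0 keeps the set non-empty even for empty \<open>X\<close> and gives
    \<open>0 \<le> T\<close>.\<close>
  define T where "T = Max (insert 0 (f ` (X \<times> X)))"
  have fin: "finite (insert 0 (f ` (X \<times> X)))"
    using \<open>finite X\<close> by simp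
  have T0: "0 \<le> T"
    unfolding T_def using fin by (intro Max_ge) auto
  have fT: "f p \<le> T" if "p \<in> X \<times> X" for p
    unfolding T_def using fin that by (intro Max_ge) auto
  have "\<theta> t = \<theta> T" if t: "T \<le> t" for t
  proof (rule partition_on_eqI)
    show "partition_on X (\<theta> t)" "partition_on X (\<theta> T)"
      using \<theta> T0 t by (auto intro: partial_dendrograms_partition_on)
    fix x y assume "x \<in> X" "y \<in> X"
    \<comment> \<open>A pair joined at \<open>t\<close> is joined at \<open>f (x, y)\<close>, which
      is at most \<open>T\<close>, hence at \<open>T\<close>; the converse is monotonicity.\<close>
    then show "same_block (\<theta> t) x y \<longleftrightarrow> same_block (\<theta> T) x y"
      using f[where p = "(x, y)" and t = t] fT[of "(x, y)"] T0 t
        partial_dendrograms_same_block_mono[OF \<theta>, of "f (x, y)" T x y]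
        partial_dendrograms_same_block_mono[OF \<theta>, of T t x y] by auto
  qed
  with T0 that show thesis by blast
qed

section \<open>Eventual value and diameter\<close>

lemma eventual_value_eq:
  assumes "\<And>t. (T::real) \<le> t \<Longrightarrow> \<theta> t = \<theta> T"
  shows "eventual_value \<theta> = \<theta> T"
  unfolding eventual_value_def
proof (rule the_equality)
  show ev: "\<forall>\<^sub>F t in at_top. \<theta> t = \<theta> T"
    unfolding eventually_at_top_linorder using assms by blast
  fix P assume "\<forall>\<^sub>F t in at_top. \<theta> t = P"
  \<comment> \<open>Two eventual values agree at some height because \<open>at_top\<close> on the
    reals is a proper filter.\<close>
  with ev have "\<forall>\<^sub>F t::real in at_top. P = \<theta> T"
    by eventually_elim simp
  then show "P = \<theta> T"
    by simp
qed

lemma dendrogram_diam: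
  assumes "finite X" and \<theta>: "\<theta> \<in> partial_dendrograms X r"
  shows dendrogram_diam_nonneg: "0 \<le> dendrogram_diam \<theta>"
    and eq_eventual_value_iff:
      "\<And>t. 0 \<le> t \<Longrightarrow> \<theta> t = eventual_value \<theta> \<longleftrightarrow> dendrogram_diam \<theta> \<le> t"
proof -
  obtain T where T: "0 \<le> T" "\<And>t. T \<le> t \<Longrightarrow> \<theta> t = \<theta> T"
    using partial_dendrograms_eventually_const[OF assms] by blast
  have ev: "eventual_value \<theta> = \<theta> T"
    by (rule eventual_value_eq) (rule T(2))
  \<comment> \<open>\<open>\<theta> t\<close> is squeezed by refinement between
    \<open>\<theta> s\<close> and \<open>\<theta> (max t T)\<close>, both equal to the eventual
    value.\<close>
  have up: "\<theta> t = eventual_value \<theta>" if "0 \<le> s" "s \<le> t" "\<theta> s = eventual_value \<theta>" for s t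
  proof (rule partition_on_eqI)
    show "partition_on X (\<theta> t)" "partition_on X (eventual_value \<theta>)"
      using that \<theta> T(1) ev by (auto intro: partial_dendrograms_partition_on)
    have "\<theta> (max t T) = eventual_value \<theta>"
      using T(2)[of "max t T"] ev by simp
    then show "same_block (\<theta> t) x y \<longleftrightarrow> same_block (eventual_value \<theta>) x y" for x y
      using that partial_dendrograms_same_block_mono[OF \<theta>, of s t x y]
        partial_dendrograms_same_block_mono[OF \<theta>, of t "max t T" x y] by auto
  qed
  note L = partial_dendrograms_Least[OF \<theta>, where Q = "\<lambda>P. P = eventual_value \<theta>",
      folded dendrogram_diam_def, OF up T(1) ev[symmetric]]
  show "0 \<le> dendrogram_diam \<theta>"
    by (rule L(1))
  show "\<And>t. 0 \<le> t \<Longrightarrow> \<theta> t = eventual_value \<theta> \<longleftrightarrow> dendrogram_diam \<theta> \<le> t"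
    by (rule L(2))
qed

lemma eventual_value_eq_diam:
  assumes "finite X" "\<theta> \<in> partial_dendrograms X r"
  shows "eventual_value \<theta> = \<theta> (dendrogram_diam \<theta>)"
  using dendrogram_diam[OF assms] by auto

section \<open>Values of the completion\<close>

lemma ultrametric_completion_apply:
  assumes "x \<in> X" "y \<in> X"
  shows "ultrametric_completion X \<epsilon> \<theta> (x, y) =
    (if same_block (eventual_value \<theta>) x y then LEAST t. 0 \<le> t \<and> same_block (\<theta> t) x y
     else dendrogram_diam \<theta> + \<epsilon>)"
  unfolding ultrametric_completion_def same_block_def using assms by simp

lemma ultrametric_completion_not_joined:
  assumes "x \<in> X" "y \<in> X" "\<not> same_block (eventual_value \<theta>) x y"
  shows "ultrametric_completion X \<epsilon> \<theta> (x, y) = dendrogram_diam \<theta> + \<epsilon>"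
  using assms by (simp add: ultrametric_completion_apply)

text \<open>For such a pair the value is an attained minimum over joining heights. It is at most the
  diameter because the eventual value is already reached there.\<close>

lemma ultrametric_completion_joined:
  assumes "finite X" "\<theta> \<in> partial_dendrograms X r" "x \<in> X" "y \<in> X"
    and "same_block (eventual_value \<theta>) x y"
  shows "0 \<le> ultrametric_completion X \<epsilon> \<theta> (x, y)"
    and "\<And>t. 0 \<le> t \<Longrightarrow>
      same_block (\<theta> t) x y \<longleftrightarrow> ultrametric_completion X \<epsilon> \<theta> (x, y) \<le> t"
    and "ultrametric_completion X \<epsilon> \<theta> (x, y) \<le> dendrogram_diam \<theta>"
proof -
  have sb: "same_block (\<theta> (dendrogram_diam \<theta>)) x y"
    using assms eventual_value_eq_diam by metis
  note nn = dendrogram_diam_nonneg[OF assms(1,2)]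
  note L = partial_dendrograms_Least[OF assms(2), where Q = "\<lambda>P. same_block P x y",
      OF partial_dendrograms_same_block_mono[OF assms(2)] nn sb]
  have eq: "ultrametric_completion X \<epsilon> \<theta> (x, y) = (LEAST t. 0 \<le> t \<and> same_block (\<theta> t) x y)"
    using assms by (simp add: ultrametric_completion_apply)
  show "0 \<le> ultrametric_completion X \<epsilon> \<theta> (x, y)"
    unfolding eq by (rule L(1))
  show iff: "\<And>t. 0 \<le> t \<Longrightarrow>
      same_block (\<theta> t) x y \<longleftrightarrow> ultrametric_completion X \<epsilon> \<theta> (x, y) \<le> t"
    unfolding eq by (rule L(2))
  show "ultrametric_completion X \<epsilon> \<theta> (x, y) \<le> dendrogram_diam \<theta>"
    using iff[OF nn] sb by blast
qed

text \<open>One criterion for joined and never joined pairs alike, recovering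
  \<open>\<theta> t\<close> from the completion and the diameter. Joined pairs have values up to the
  diameter, so the cap in \<open>min\<close> does not affect them; the value of any other pair
  exceeds the diameter since \<open>\<epsilon> > 0\<close>, so the cap excludes it at every
  height.\<close>

lemma same_block_iff_ultrametric_completion:
  assumes fin: "finite X" and \<theta>: "\<theta> \<in> partial_dendrograms X r" and xy: "x \<in> X" "y \<in> X"
    and "\<epsilon> > 0" and "0 \<le> t"
  shows "same_block (\<theta> t) x y \<longleftrightarrow>
    ultrametric_completion X \<epsilon> \<theta> (x, y) \<le> min t (dendrogram_diam \<theta>)"
proof (cases "same_block (eventual_value \<theta>) x y")
  case True
  then show ?thesis
    using ultrametric_completion_joined(2)[OF fin \<theta> xy True, of t \<epsilon>]
      ultrametric_completion_joined(3)[OF fin \<theta> xy True, of \<epsilon>] \<open>0 \<le> t\<close> by auto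
next
  case False
  have "\<theta> (max t (dendrogram_diam \<theta>)) = eventual_value \<theta>"
    using eq_eventual_value_iff[OF fin \<theta>, of "max t (dendrogram_diam \<theta>)"] \<open>0 \<le> t\<close> by simp
  then have "\<not> same_block (\<theta> t) x y"
    using False \<open>0 \<le> t\<close> \<theta>
      partial_dendrograms_same_block_mono[OF \<theta>, of t "max t (dendrogram_diam \<theta>)" x y] by auto
  then show ?thesis
    using ultrametric_completion_not_joined[OF xy False, of \<epsilon>] \<open>\<epsilon> > 0\<close> by simp
qed

section \<open>The completion is an ultrametric\<close>

lemma ultrametric_completion_in_ultrametrics:
  assumes fin: "finite X" and \<theta>: "\<theta> \<in> partial_dendrograms X r" and "\<epsilon> > 0"
  shows "ultrametric_completion X \<epsilon> \<theta> \<in> ultrametrics X"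
proof -
  let ?d = "ultrametric_completion X \<epsilon> \<theta>" and ?D = "dendrogram_diam \<theta>"
  let ?E = "same_block (eventual_value \<theta>)"
  have D0: "0 \<le> ?D"
    by (rule dendrogram_diam_nonneg[OF fin \<theta>])
  have le: "?d (x, y) \<le> ?D + \<epsilon>" if "x \<in> X" "y \<in> X" for x y
    using ultrametric_completion_joined(3)[OF fin \<theta> that, of \<epsilon>]
      ultrametric_completion_not_joined[OF that, of \<theta> \<epsilon>] \<open>\<epsilon> > 0\<close>
    by (cases "?E x y") auto
  have nonneg: "0 \<le> ?d (x, y)" if "x \<in> X" "y \<in> X" for x y
    using ultrametric_completion_joined(1)[OF fin \<theta> that, of \<epsilon>]
      ultrametric_completion_not_joined[OF that, of \<theta> \<epsilon>] \<open>\<epsilon> > 0\<close> D0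
    by (cases "?E x y") auto
  have "?d (x, x) = 0" if "x \<in> X" for x
  proof -
    have "same_block (\<theta> 0) x x"
      using \<theta> that by (auto intro: same_block_refl partial_dendrograms_partition_on)
    then show ?thesis
      using same_block_iff_ultrametric_completion[OF fin \<theta> that that \<open>\<epsilon> > 0\<close>, of 0]
        nonneg[OF that that] by simp
  qed
  moreover have "?d (x, y) = ?d (y, x)" if "x \<in> X" "y \<in> X" for x y
    using that same_block_commute[of _ x y] by (simp add: ultrametric_completion_apply)
  moreover have "?d (x, z) \<le> max (?d (x, y)) (?d (y, z))"
    if xyz: "x \<in> X" "y \<in> X" "z \<in> X" for x y z
  proof (cases "?E x y \<and> ?E y z")
    case True
    let ?t = "max (?d (x, y)) (?d (y, z))"
    have t: "0 \<le> ?t"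
      using nonneg[OF xyz(1,2)] by simp
    \<comment> \<open>By height \<open>?t\<close> both pairs are joined, and transitivity of the
      same-block relation joins \<open>x\<close> and \<open>z\<close> no later.\<close>
    have "same_block (\<theta> ?t) x y" "same_block (\<theta> ?t) y z"
      using True ultrametric_completion_joined(2)[OF fin \<theta> xyz(1,2), of ?t \<epsilon>]
        ultrametric_completion_joined(2)[OF fin \<theta> xyz(2,3), of ?t \<epsilon>] t by auto
    then have "same_block (\<theta> ?t) x z"
      using same_block_trans partial_dendrograms_partition_on[OF \<theta> t] by metis
    then show ?thesis
      using same_block_iff_ultrametric_completion[OF fin \<theta> xyz(1,3) \<open>\<epsilon> > 0\<close> t] by simp
  next
    case False
    \<comment> \<open>One of the two pairs is never joined and takes the value
      \<open>?D + \<epsilon>\<close>, which bounds all distances.\<close>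
    then have "?d (x, y) = ?D + \<epsilon> \<or> ?d (y, z) = ?D + \<epsilon>"
      using xyz ultrametric_completion_not_joined by metis
    then show ?thesis
      using le[OF xyz(1,3)] by auto
  qed
  moreover have "?d \<in> X \<times> X \<rightarrow>\<^sub>E {0..}"
    using nonneg by (auto simp: PiE_iff ultrametric_completion_def extensional_def)
  ultimately show ?thesis
    by (simp add: ultrametrics_def)
qed

section \<open>Injectivity\<close>

text \<open>The eventual value is itself a regular partition, so it separates \<open>a\<close> and
  \<open>b\<close>. Such a pair makes the diameter readable from the completion.\<close>

lemma ultrametric_completion_less:
  assumes "finite X" "\<theta> \<in> partial_dendrograms X r" "a \<in> X" "b \<in> X" "(a, b) \<in> r"
  shows "ultrametric_completion X \<epsilon> \<theta> (a, b) = dendrogram_diam \<theta> + \<epsilon>"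
proof (rule ultrametric_completion_not_joined)
  show "\<not> same_block (eventual_value \<theta>) a b"
    unfolding eventual_value_eq_diam[OF assms(1,2)]
    using regular_partitions_not_same_block partial_dendrograms_regular
      dendrogram_diam_nonneg assms by metis
qed (use assms in auto)

lemma inj_on_ultrametric_completion:
  assumes fin: "finite X" and ab: "a \<in> X" "b \<in> X" "(a, b) \<in> r" and "\<epsilon> > 0"
  shows "inj_on (ultrametric_completion X \<epsilon>) (partial_dendrograms X r)"
proof (rule inj_onI)
  fix \<theta> \<eta> assume \<theta>: "\<theta> \<in> partial_dendrograms X r" and \<eta>: "\<eta> \<in> partial_dendrograms X r"
    and eq: "ultrametric_completion X \<epsilon> \<theta> = ultrametric_completion X \<epsilon> \<eta>"
  have diam: "dendrogram_diam \<theta> = dendrogram_diam \<eta>"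
    using ultrametric_completion_less[OF fin \<theta> ab, of \<epsilon>]
      ultrametric_completion_less[OF fin \<eta> ab, of \<epsilon>] eq by simp
  show "\<theta> = \<eta>"
  \<comment> \<open>Dendrograms are extensional on the non-negative reals, so only heights
    \<open>t \<ge> 0\<close> need comparing.\<close>
  proof (rule PiE_ext)
    show "\<theta> \<in> {0..} \<rightarrow>\<^sub>E regular_partitions X r" "\<eta> \<in> {0..} \<rightarrow>\<^sub>E regular_partitions X r"
      using \<theta> \<eta> by (auto simp: partial_dendrograms_def)
    fix t :: real assume "t \<in> {0..}"
    then have t: "0 \<le> t" by simp
    show "\<theta> t = \<eta> t"
    proof (rule partition_on_eqI)
      show "partition_on X (\<theta> t)" "partition_on X (\<eta> t)"
        using \<theta> \<eta> t by (auto intro: partial_dendrograms_partition_on)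
      fix x y assume "x \<in> X" "y \<in> X"
      \<comment> \<open>Equal completions and equal diameters make the two criteria for being joined
        at \<open>t\<close> identical.\<close>
      then show "same_block (\<theta> t) x y \<longleftrightarrow> same_block (\<eta> t) x y"
        using same_block_iff_ultrametric_completion[OF fin \<theta> _ _ \<open>\<epsilon> > 0\<close> t]
          same_block_iff_ultrametric_completion[OF fin \<eta> _ _ \<open>\<epsilon> > 0\<close> t] eq diam by simp
    qed
  qed
qed

theorem theorem20:
  fixes X :: "'a set" and r :: "('a \<times> 'a) set" and \<epsilon> :: real
  assumes "finite X"
    and "strict_poset X r"
    and "\<exists>a\<in>X. \<exists>b\<in>X. (a, b) \<in> r"
    and "\<epsilon> > 0"
  shows "ultrametric_completion X \<epsilon> \<in> partial_dendrograms X r \<rightarrow> ultrametrics X \<and>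
         inj_on (ultrametric_completion X \<epsilon>) (partial_dendrograms X r)"
proof
  show "ultrametric_completion X \<epsilon> \<in> partial_dendrograms X r \<rightarrow> ultrametrics X"
    by (rule Pi_I) (rule ultrametric_completion_in_ultrametrics[OF assms(1) _ assms(4)])
  show "inj_on (ultrametric_completion X \<epsilon>) (partial_dendrograms X r)"
    using assms(3) inj_on_ultrametric_completion[OF assms(1) _ _ _ assms(4)] by blast
qed

end
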